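(* Let $b\in\mathbb{R}^D$. For all $\rho=(\rho_1,\dots,\rho_p)\in\mathbb{R}^p$ and $j_0,k_0\in\{1,\dots,p\}$, writing $S_l(\rho)=\gamma_{1,l}e^{-\rho_1}+\dots+\gamma_{p,l}e^{-\rho_p}$ for $l\in\mathcal{D}^+$, the function $\rho\mapsto\log p(\rho\mid b)$ satisfies $$\partial_{j_0}\log p(\rho\mid b)=-\frac12\sum_{l\in\mathcal{D}^+}\frac{\gamma_{j_0,l}e^{-\rho_{j_0}}}{S_l(\rho)}+\frac12 b^TK_{j_0}b\,e^{-\rho_{j_0}}+\partial_{j_0}\log q(\rho),$$ $$\partial^2_{j_0}\log p(\rho\mid b)=-\frac12\sum_{l\in\mathcal{D}^+}\left\{\left(\frac{\gamma_{j_0,l}e^{-\rho_{j_0}}}{S_l(\rho)}\right)^2-\frac{\gamma_{j_0,l}e^{-\rho_{j_0}}}{S_l(\rho)}\right\}-\frac12 b^TK_{j_0}b\,e^{-\rho_{j_0}}+\partial^2_{j_0}\log q(\rho),$$ and, if $j_0\neq k_0$, $$\partial_{j_0}\partial_{k_0}\log p(\rho\mid b)=-\frac12\sum_{l\in\mathcal{D}^+}\frac{\gamma_{j_0,l}e^{-\rho_{j_0}}\gamma_{k_0,l}e^{-\rho_{k_0}}}{S_l(\rho)^2}+\partial_{j_0}\partial_{k_0}\log q(\rho).$$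
   Context: Let $p\geq 2$ and let $d_1,\dots,d_p$ be the dimensions of $p$ (cubic) B-spline bases (so $d_j\ge 4$); $D=\prod_{j=1}^p d_j$. For each $j$, the marginal penalty matrix is the $d_j\times d_j$ second order differences penalty matrix $\widetilde{K}_j=\Delta_j^T\Delta_j$, where $\Delta_j$ is the $(d_j-2)\times d_j$ second order difference matrix, $(\Delta_j v)_i=v_i-2v_{i+1}+v_{i+2}$. With $I_d$ the $d\times d$ identity and $\otimes$ the Kronecker product, set $K_j=I_{d_1}\otimes\dots\otimes I_{d_{j-1}}\otimes\widetilde{K}_j\otimes I_{d_{j+1}}\otimes\dots\otimes I_{d_p}$ and, for $\tau^2\in(0,\infty)^p$, $K(\tau^2)=K_1/\tau_1^2+\dots+K_p/\tau_p^2$. Let $\widetilde{K}_j=\widetilde{Q}_j\widetilde{\Gamma}_j\widetilde{Q}_j^T$ be eigendecompositions ($\widetilde Q_j$ orthogonal, $\widetilde\Gamma_j$ diagonal), $\Gamma_j=I_{d_1}\otimes\dots\otimes I_{d_{j-1}}\otimes\widetilde{\Gamma}_j\otimes I_{d_{j+1}}\otimes\dots\otimes I_{d_p}$, let $\gamma_{j,l}$, $l=1,\dots,D$, be the diagonal entries of $\Gamma_j$, and let $\mathcal{D}^+\subseteq\{1,\dots,D\}$ be the set of $l$ for which there is some $j$ with $\gamma_{j,l}>0$. For $\rho\in\mathbb{R}^p$ write $e^\rho=(e^{\rho_1},\dots,e^{\rho_p})$. Let $q:\mathbb{R}^p\to(0,\infty)$ be a twice differentiable function (a kernel of the prior density of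 the log-smoothing variances $\rho$). The log-full conditional posterior of $\rho$ given $b$ is, up to an additive constant not depending on $\rho$ (which is irrelevant for derivatives), $$\log p(\rho\mid b)=\frac12\log\mathrm{Det}(K(e^\rho))-\frac12 b^TK(e^\rho)b+\log q(\rho),$$ where $\mathrm{Det}$ is the pseudo-determinant, i.e. the product of the nonzero eigenvalues counted with multiplicity. $\partial_j$ denotes the partial derivative with respect to $\rho_j$. *)

theory Defs
  imports
    "HOL-Analysis.Analysis"
    "Jordan_Normal_Form.Char_Poly"
begin

no_notation vec_index (infixl "$" 100)

text \<open>Matrices and vectors of variable size (type \<open>mat\<close>, indices starting at 0) are used for the
  penalties; \<open>real ^ 'p\<close> is used for the log-smoothing variances. The order of the Kronecker factors
  is the order of the finite linearly ordered index type \<open>'p\<close>, which plays the role of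
  \<open>{1, \<dots>, p}\<close>.\<close>

definition kron :: "real mat \<Rightarrow> real mat \<Rightarrow> real mat" where
  "kron A B = mat (dim_row A * dim_row B) (dim_col A * dim_col B)
     (\<lambda>(r, c). A $$ (r div dim_row B, c div dim_col B) * B $$ (r mod dim_row B, c mod dim_col B))"

definition kron_all :: "('p::{finite,linorder} \<Rightarrow> real mat) \<Rightarrow> real mat" where
  "kron_all M = foldr kron (map M (sorted_list_of_set UNIV)) (1\<^sub>m 1)"

definition kron_at :: "('p::{finite,linorder} \<Rightarrow> nat) \<Rightarrow> 'p \<Rightarrow> real mat \<Rightarrow> real mat" where
  "kron_at d j M = kron_all (\<lambda>i. if i = j then M else 1\<^sub>m (d i))"

definition diff2_mat :: "nat \<Rightarrow> real mat" where
  "diff2_mat n = mat (n - 2) n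
     (\<lambda>(r, c). if c = r then 1 else if c = r + 1 then - 2 else if c = r + 2 then 1 else 0)"

definition marginal_penalty :: "nat \<Rightarrow> real mat" where
  "marginal_penalty n = transpose_mat (diff2_mat n) * diff2_mat n"

definition total_dim :: "('p::finite \<Rightarrow> nat) \<Rightarrow> nat" where
  "total_dim d = (\<Prod>j\<in>UNIV. d j)"

definition penalty :: "('p::{finite,linorder} \<Rightarrow> nat) \<Rightarrow> 'p \<Rightarrow> real mat" where
  "penalty d j = kron_at d j (marginal_penalty (d j))"

text \<open>The argument \<open>\<tau>2\<close> is the vector of the \<open>\<tau>\<^sub>j\<^sup>2\<close>; the sum of matrices is written entrywise.\<close>

definition full_penalty :: "('p::{finite,linorder} \<Rightarrow> nat) \<Rightarrow> real ^ 'p::{finite,linorder} \<Rightarrow> real mat" where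
  "full_penalty d \<tau>2 = mat (total_dim d) (total_dim d)
     (\<lambda>(r, c). \<Sum>j\<in>UNIV. penalty d j $$ (r, c) / (\<tau>2 $ j))"

text \<open>Only real eigenvalues are taken into account, which are all of them for the symmetric matrices
  considered here; \<open>order\<close> is the (algebraic) multiplicity.\<close>

definition pseudo_det :: "real mat \<Rightarrow> real" where
  "pseudo_det A = (\<Prod>e | eigenvalue A e \<and> e \<noteq> 0. e ^ order e (char_poly A))"

definition quad_form :: "real mat \<Rightarrow> real Matrix.vec \<Rightarrow> real" where
  "quad_form A b = scalar_prod b (A *\<^sub>v b)"

text \<open>Note that \<open>orthogonal_mat\<close> of the library only demands pairwise orthogonal nonzero columns.\<close>

definition orthogonal_eigendecomposition ::
    "nat \<Rightarrow> real mat \<Rightarrow> real mat \<Rightarrow> real mat \<Rightarrow> bool" where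
  "orthogonal_eigendecomposition n A Q G \<longleftrightarrow>
     Q \<in> carrier_mat n n \<and> transpose_mat Q * Q = 1\<^sub>m n \<and> Q * transpose_mat Q = 1\<^sub>m n \<and>
     G \<in> carrier_mat n n \<and> diagonal_mat G \<and> A = Q * G * transpose_mat Q"

definition gamma :: "('p::{finite,linorder} \<Rightarrow> nat) \<Rightarrow> ('p \<Rightarrow> real mat) \<Rightarrow> 'p \<Rightarrow> nat \<Rightarrow> real" where
  "gamma d G j l = kron_at d j (G j) $$ (l, l)"

definition pos_index :: "('p::{finite,linorder} \<Rightarrow> nat) \<Rightarrow> ('p \<Rightarrow> real mat) \<Rightarrow> nat set" where
  "pos_index d G = {l. l < total_dim d \<and> (\<exists>j. gamma d G j l > 0)}"

definition S_sum ::
    "('p::{finite,linorder} \<Rightarrow> nat) \<Rightarrow> ('p \<Rightarrow> real mat) \<Rightarrow> nat \<Rightarrow> real ^ 'p::{finite,linorder} \<Rightarrow> real" where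
  "S_sum d G l \<rho> = (\<Sum>j\<in>UNIV. gamma d G j l * exp (- (\<rho> $ j)))"

definition exp_vec :: "real ^ 'p \<Rightarrow> real ^ 'p" where
  "exp_vec \<rho> = (\<chi> j. exp (\<rho> $ j))"

definition log_full_conditional ::
    "('p::{finite,linorder} \<Rightarrow> nat) \<Rightarrow> real Matrix.vec \<Rightarrow> (real ^ 'p::{finite,linorder} \<Rightarrow> real) \<Rightarrow>
      real ^ 'p::{finite,linorder} \<Rightarrow> real" where
  "log_full_conditional d b q \<rho> =
     1 / 2 * ln (pseudo_det (full_penalty d (exp_vec \<rho>)))
     - 1 / 2 * quad_form (full_penalty d (exp_vec \<rho>)) b + ln (q \<rho>)"

definition twice_differentiable :: "('a::real_normed_vector \<Rightarrow> real) \<Rightarrow> bool" where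
  "twice_differentiable f \<longleftrightarrow>
     (\<exists>f' :: 'a \<Rightarrow> 'a \<Rightarrow>\<^sub>L real. \<forall>x. (f has_derivative blinfun_apply (f' x)) (at x)
        \<and> f' differentiable (at x))"

definition has_partial_derivative ::
    "(real ^ 'p \<Rightarrow> real) \<Rightarrow> 'p::finite \<Rightarrow> real ^ 'p \<Rightarrow> real \<Rightarrow> bool" where
  "has_partial_derivative f j x c \<longleftrightarrow>
     ((\<lambda>t. f (x + t *\<^sub>R axis j 1)) has_real_derivative c) (at 0)"

definition partial_derivative :: "'p::finite \<Rightarrow> (real ^ 'p \<Rightarrow> real) \<Rightarrow> real ^ 'p \<Rightarrow> real" where
  "partial_derivative j f x = deriv (\<lambda>t. f (x + t *\<^sub>R axis j 1)) 0"

end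

theory Submission
  imports Defs
begin

text \<open>The factors \<open>Q\<^sub>j\<close> diagonalise all penalties \<open>K\<^sub>j\<close> simultaneously: with \<open>U\<close> the Kronecker product of
  the \<open>Q\<^sub>j\<close>, the mixed-product property gives \<open>K\<^sub>j = U \<Gamma>\<^sub>j U\<^sup>T\<close>. Hence \<open>K(e\<^sup>\<rho>)\<close> is similar to the diagonal
  matrix with entries \<open>S\<^sub>l(\<rho>)\<close>. These are nonnegative, because each marginal penalty is a Gram matrix,
  and they vanish exactly outside \<open>pos_index\<close>, a set that does not depend on \<open>\<rho>\<close>. So the logarithm of
  the pseudo-determinant is the sum of the \<open>ln S\<^sub>l\<close> over \<open>pos_index\<close>, and the claim is reduced to
  calculus along the coordinate directions.\<close>

section \<open>Kronecker products of two matrices\<close>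

lemma kron_carrier:
  assumes "A \<in> carrier_mat m n" "B \<in> carrier_mat m' n'"
  shows "kron A B \<in> carrier_mat (m * m') (n * n')"
  using assms by (auto simp: kron_def)

lemma div_lt_of_lt_mult: "r < m * k \<Longrightarrow> r div k < m" for r m k :: nat
  by (simp add: less_mult_imp_div_less)

lemma mod_lt_of_lt_mult: "r < m * k \<Longrightarrow> r mod k < k" for r m k :: nat
  by (cases "k = 0") auto

text \<open>Mixed-product property: the inner summation index splits uniquely as
  \<open>j + i * n'\<close> with \<open>i < n\<close> and \<open>j < n'\<close>, so the sum becomes
  a double sum that factors.\<close>

lemma kron_mult:
  assumes A: "A \<in> carrier_mat m n" and C: "C \<in> carrier_mat n k"
    and B: "B \<in> carrier_mat m' n'" and D: "D \<in> carrier_mat n' k'"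
  shows "kron A B * kron C D = kron (A * C) (B * D)"
proof (rule eq_matI)
  fix r c assume "r < dim_row (kron (A * C) (B * D))" "c < dim_col (kron (A * C) (B * D))"
  then have r: "r < m * m'" and c: "c < k * k'"
    using assms by (auto simp: kron_def)
  note bnd = div_lt_of_lt_mult[OF r] mod_lt_of_lt_mult[OF r]
    div_lt_of_lt_mult[OF c] mod_lt_of_lt_mult[OF c]
  \<comment> \<open>Entries of a matrix are specified only inside its dimensions, so the composed
    index has to be bounded before \<open>kron_def\<close> can be applied at it.\<close>
  have lt: "j + i * n' < n * n'" if "i < n" "j < n'" for i j
  proof -
    have "j + i * n' < Suc i * n'" using that by simp
    also have "\<dots> \<le> n * n'" using that by (intro mult_le_mono1) simp
    finally show ?thesis .
  qed
  have "(kron A B * kron C D) $$ (r, c) = (\<Sum>l<n * n'. kron A B $$ (r, l) * kron C D $$ (l, c))"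
    using assms r c kron_carrier[OF A B] kron_carrier[OF C D]
    by (simp add: scalar_prod_def atLeast0LessThan)
  also have "\<dots> = (\<Sum>i<n. \<Sum>j<n'. kron A B $$ (r, j + i * n') * kron C D $$ (j + i * n', c))"
    by (rule sum_mult_product)
  also have "\<dots> = (\<Sum>i<n. \<Sum>j<n'. (A $$ (r div m', i) * C $$ (i, c div k'))
                * (B $$ (r mod m', j) * D $$ (j, c mod k')))"
    using assms r c lt by (intro sum.cong refl) (auto simp: kron_def)
  also have "\<dots> = (A * C) $$ (r div m', c div k') * (B * D) $$ (r mod m', c mod k')"
    using assms bnd by (simp add: scalar_prod_def atLeast0LessThan sum_product)
  also have "\<dots> = kron (A * C) (B * D) $$ (r, c)"
    using assms r c by (auto simp: kron_def)
  finally show "(kron A B * kron C D) $$ (r, c) = kron (A * C) (B * D) $$ (r, c)" .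
qed (use assms in \<open>auto simp: kron_def\<close>)

lemma kron_transpose: "transpose_mat (kron A B) = kron (transpose_mat A) (transpose_mat B)"
proof (rule eq_matI)
  fix r c assume "r < dim_row (kron (transpose_mat A) (transpose_mat B))"
    "c < dim_col (kron (transpose_mat A) (transpose_mat B))"
  then have r: "r < dim_col A * dim_col B" and c: "c < dim_row A * dim_row B"
    by (auto simp: kron_def)
  show "transpose_mat (kron A B) $$ (r, c) = kron (transpose_mat A) (transpose_mat B) $$ (r, c)"
    using r c div_lt_of_lt_mult[OF r] mod_lt_of_lt_mult[OF r]
      div_lt_of_lt_mult[OF c] mod_lt_of_lt_mult[OF c] by (simp add: kron_def)
qed (auto simp: kron_def)

text \<open>An off-diagonal position of a Kronecker product of square matrices is off-diagonal in at
  least one factor. Hence Kronecker products preserve identity and diagonal matrices.\<close>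

lemma div_mod_eq_iff: "r div k = c div k \<and> r mod k = c mod k \<longleftrightarrow> r = c" for r c k :: nat
  by (metis div_mult_mod_eq)

lemma kron_one: "kron (1\<^sub>m m) (1\<^sub>m n) = 1\<^sub>m (m * n)"
proof (rule eq_matI)
  fix r c assume "r < dim_row (1\<^sub>m (m * n))" "c < dim_col (1\<^sub>m (m * n))"
  then have r: "r < m * n" and c: "c < m * n" by auto
  show "kron (1\<^sub>m m) (1\<^sub>m n) $$ (r, c) = 1\<^sub>m (m * n) $$ (r, c)"
    using r c div_lt_of_lt_mult[OF r] mod_lt_of_lt_mult[OF r]
      div_lt_of_lt_mult[OF c] mod_lt_of_lt_mult[OF c] div_mod_eq_iff[of r n c]
    by (auto simp: kron_def)
qed (auto simp: kron_def)

definition nonneg_diagonal :: "real mat \<Rightarrow> bool" where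
  "nonneg_diagonal A \<longleftrightarrow> diagonal_mat A \<and> (\<forall>i<dim_row A. A $$ (i, i) \<ge> 0)"

lemma nonneg_diagonal_one: "nonneg_diagonal (1\<^sub>m n)"
  by (auto simp: nonneg_diagonal_def diagonal_mat_def)

lemma nonneg_diagonal_kron:
  assumes A: "A \<in> carrier_mat m m" "nonneg_diagonal A"
    and B: "B \<in> carrier_mat n n" "nonneg_diagonal B"
  shows "nonneg_diagonal (kron A B)"
proof -
  have 1: "kron A B $$ (r, c) = 0" if r: "r < m * n" and c: "c < m * n" and "r \<noteq> c" for r c
  proof -
    have "r div n \<noteq> c div n \<or> r mod n \<noteq> c mod n" using div_mod_eq_iff[of r n c] that by blast
    then have "A $$ (r div n, c div n) = 0 \<or> B $$ (r mod n, c mod n) = 0"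
      using assms div_lt_of_lt_mult[OF r] mod_lt_of_lt_mult[OF r]
        div_lt_of_lt_mult[OF c] mod_lt_of_lt_mult[OF c]
      by (auto simp: nonneg_diagonal_def diagonal_mat_def)
    then show ?thesis using A(1) B(1) r c by (auto simp: kron_def)
  qed
  have 2: "kron A B $$ (r, r) \<ge> 0" if r: "r < m * n" for r
    using assms r div_lt_of_lt_mult[OF r] mod_lt_of_lt_mult[OF r]
    by (auto simp: kron_def nonneg_diagonal_def)
  show ?thesis
    using 1 2 kron_carrier[OF A(1) B(1)] by (auto simp: nonneg_diagonal_def diagonal_mat_def)
qed

section \<open>Iterated Kronecker products\<close>

lemma foldr_kron_carrier:
  assumes "\<And>i. M i \<in> carrier_mat (m i) (n i)"
  shows "foldr kron (map M xs) (1\<^sub>m 1) \<in> carrier_mat (prod_list (map m xs)) (prod_list (map n xs))"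
  by (induction xs) (auto intro!: kron_carrier assms)

text \<open>\<open>kron_all\<close> folds over one fixed sorted list, so the induction is carried
  out for an arbitrary list; each step is one use of the mixed-product property.\<close>

lemma foldr_kron_mult:
  assumes "\<And>i. A i \<in> carrier_mat (m i) (n i)" "\<And>i. B i \<in> carrier_mat (n i) (k i)"
  shows "foldr kron (map A xs) (1\<^sub>m 1) * foldr kron (map B xs) (1\<^sub>m 1)
    = foldr kron (map (\<lambda>i. A i * B i) xs) (1\<^sub>m 1)"
proof (induction xs)
  case (Cons x xs)
  show ?case
    using kron_mult[OF assms(1)[of x] assms(2)[of x] foldr_kron_carrier[of A m n xs, OF assms(1)]
        foldr_kron_carrier[of B n k xs, OF assms(2)]] Cons.IH
    by simp
qed simp

text \<open>The sorted list enumerates the index type without repetition, so the dimension obtained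
  from the fold does not depend on the order of the factors.\<close>

lemma prod_list_sorted_list_of_UNIV:
  "prod_list (map f (sorted_list_of_set (UNIV :: 'p::{finite,linorder} set))) = total_dim f"
  using prod.distinct_set_conv_list[of "sorted_list_of_set (UNIV :: 'p set)" f]
  by (simp add: total_dim_def)

lemma kron_all_carrier:
  assumes "\<And>i. M i \<in> carrier_mat (m i) (n i)"
  shows "kron_all M \<in> carrier_mat (total_dim m) (total_dim n)"
  using foldr_kron_carrier[of M m n, OF assms]
  unfolding kron_all_def by (metis prod_list_sorted_list_of_UNIV)

lemma kron_all_mult:
  assumes "\<And>i. A i \<in> carrier_mat (m i) (n i)" "\<And>i. B i \<in> carrier_mat (n i) (k i)"
  shows "kron_all A * kron_all B = kron_all (\<lambda>i. A i * B i)"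
  unfolding kron_all_def by (rule foldr_kron_mult[OF assms])

lemma kron_all_transpose: "transpose_mat (kron_all M) = kron_all (\<lambda>i. transpose_mat (M i))"
proof -
  have "transpose_mat (foldr kron (map M xs) (1\<^sub>m 1))
      = foldr kron (map (\<lambda>i. transpose_mat (M i)) xs) (1\<^sub>m 1)" for xs
    by (induction xs) (auto simp: kron_transpose)
  then show ?thesis unfolding kron_all_def by blast
qed

lemma kron_all_one: "kron_all (\<lambda>i. 1\<^sub>m (n i)) = 1\<^sub>m (total_dim n)"
proof -
  have "foldr kron (map (\<lambda>i. 1\<^sub>m (n i)) xs) (1\<^sub>m 1) = 1\<^sub>m (prod_list (map n xs))" for xs
    by (induction xs) (auto simp: kron_one)
  then show ?thesis unfolding kron_all_def by (metis prod_list_sorted_list_of_UNIV)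
qed

lemma nonneg_diagonal_kron_all:
  assumes "\<And>i. M i \<in> carrier_mat (n i) (n i)" "\<And>i. nonneg_diagonal (M i)"
  shows "nonneg_diagonal (kron_all M)"
proof -
  have "nonneg_diagonal (foldr kron (map M xs) (1\<^sub>m 1))" for xs
  proof (induction xs)
    case (Cons x xs)
    show ?case
      using nonneg_diagonal_kron[OF assms(1,2)[of x] foldr_kron_carrier[of M n n xs, OF assms(1)] Cons.IH]
      by simp
  qed (simp add: nonneg_diagonal_one)
  then show ?thesis unfolding kron_all_def by blast
qed

section \<open>Nonnegativity of the marginal eigenvalues\<close>

lemma orthogonal_eigendecompositionD:
  assumes "orthogonal_eigendecomposition n A Q G"
  shows "Q \<in> carrier_mat n n" "G \<in> carrier_mat n n" "transpose_mat Q * Q = 1\<^sub>m n"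
    "Q * transpose_mat Q = 1\<^sub>m n" "diagonal_mat G" "A = Q * G * transpose_mat Q"
  using assms by (auto simp: orthogonal_eigendecomposition_def)

text \<open>Solving the decomposition for \<open>G\<close> gives \<open>G = (X Q)^T (X Q)\<close>,
  so its diagonal entries are squared norms of the columns of \<open>X Q\<close>.\<close>

lemma gram_nonneg_diagonal:
  assumes dec: "orthogonal_eigendecomposition n (transpose_mat X * X) Q G"
    and X: "X \<in> carrier_mat m n"
  shows "nonneg_diagonal G"
proof -
  note D = orthogonal_eigendecompositionD[OF dec]
  have Qt: "transpose_mat Q \<in> carrier_mat n n" and Xt: "transpose_mat X \<in> carrier_mat n m"
    using D(1) X by auto
  have "transpose_mat (X * Q) * (X * Q) = (transpose_mat Q * transpose_mat X) * (X * Q)"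
    using transpose_mult[OF X D(1)] by simp
  also have "\<dots> = transpose_mat Q * ((transpose_mat X * X) * Q)"
    using assoc_mult_mat[OF Qt Xt mult_carrier_mat[OF X D(1)]] assoc_mult_mat[OF Xt X D(1)] by simp
  also have "\<dots> = transpose_mat Q * ((Q * G * transpose_mat Q) * Q)"
    using D(6) by simp
  also have "(Q * G * transpose_mat Q) * Q = Q * G"
    using assoc_mult_mat[OF mult_carrier_mat[OF D(1,2)] Qt D(1)] D(1,2,3)
    by (metis mult_carrier_mat right_mult_one_mat)
  also have "transpose_mat Q * (Q * G) = G"
    using assoc_mult_mat[OF Qt D(1,2)] D(2,3) by (metis left_mult_one_mat)
  finally have G: "G = transpose_mat (X * Q) * (X * Q)" ..
  have "G $$ (i, i) \<ge> 0" if "i < n" for i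
    using that X D(1) by (subst G) (auto simp: scalar_prod_def intro!: sum_nonneg)
  then show ?thesis using D(2,5) by (auto simp: nonneg_diagonal_def)
qed

lemma diff2_mat_carrier: "diff2_mat n \<in> carrier_mat (n - 2) n"
  by (simp add: diff2_mat_def)

section \<open>Pseudo-determinant of a diagonalisable matrix\<close>

lemma order_prod_linear:
  fixes s :: "'a \<Rightarrow> real"
  assumes "finite L"
  shows "order e (\<Prod>l\<in>L. [:- s l, 1:]) = card {l\<in>L. s l = e}"
  using assms
proof (induction L)
  case (insert x L)
  \<comment> \<open>Orders add up only for a nonzero product.\<close>
  have "[:- s x, 1:] * (\<Prod>l\<in>L. [:- s l, 1:]) \<noteq> 0"
    using insert.hyps by (simp del: mult_pCons_left)
  then have "order e ([:- s x, 1:] * (\<Prod>l\<in>L. [:- s l, 1:]))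
      = order e [:- s x, 1:] + order e (\<Prod>l\<in>L. [:- s l, 1:])"
    by (rule order_mult)
  moreover have "order e [:- s x, 1:] = (if s x = e then 1 else 0)"
    using order_power_n_n[of e 1] by (auto intro: order_0I)
  moreover have "{l \<in> insert x L. s l = e} = (if s x = e then insert x {l\<in>L. s l = e} else {l\<in>L. s l = e})"
    by auto
  ultimately show ?case using insert by (simp del: mult_pCons_left)
qed (simp add: order_0I)

text \<open>Similarity preserves the characteristic polynomial, here a product of linear factors. As
  \<open>s\<close> may repeat values, the product over distinct eigenvalues with multiplicities has
  to be regrouped into one over indices.\<close>

lemma pseudo_det_similar_diagonal:
  assumes sim: "similar_mat A (mat n n (\<lambda>(i, j). if i = j then s i else 0))"
  shows "pseudo_det A = (\<Prod>l | l < n \<and> s l \<noteq> 0. s l)"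
proof -
  let ?D = "mat n n (\<lambda>(i, j). if i = j then s i else 0)"
  have A: "A \<in> carrier_mat n n" using similar_matD[OF sim] by (metis (no_types, lifting) carrier_matD(1) dim_row_mat(1) insert_subset)
  have "char_poly A = char_poly ?D" by (rule char_poly_similar[OF sim])
  also have "\<dots> = (\<Prod>a\<leftarrow>diag_mat ?D. [:- a, 1:])"
    by (rule char_poly_upper_triangular[of _ n]) (auto simp: upper_triangular_def)
  also have "\<dots> = prod_list (map (\<lambda>l. [:- s l, 1:]) [0..<n])"
    by (auto simp: diag_mat_def intro!: arg_cong[where f = prod_list])
  also have "\<dots> = (\<Prod>l<n. [:- s l, 1:])"
    by (simp add: prod.distinct_set_conv_list[symmetric] atLeast0LessThan)
  finally have cp: "char_poly A = (\<Prod>l<n. [:- s l, 1:])" .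
  have ev: "eigenvalue A e \<longleftrightarrow> (\<exists>l<n. s l = e)" for e
    unfolding eigenvalue_root_char_poly[OF A] cp by (auto simp: poly_prod algebra_simps)
  let ?L = "{l. l < n \<and> s l \<noteq> 0}"
  \<comment> \<open>The nonzero eigenvalues are the image of \<open>?L\<close> under
    \<open>s\<close>, and the multiplicity of each is the size of its fibre.\<close>
  have "pseudo_det A = (\<Prod>e\<in>s ` ?L. e ^ card {l. l < n \<and> s l = e})"
    unfolding pseudo_det_def cp ev
    by (intro prod.cong) (auto simp: order_prod_linear)
  \<comment> \<open>On the fibre of \<open>e\<close> every factor \<open>s l\<close> equals
    \<open>e\<close>; the fibres partition \<open>?L\<close>.\<close>
  also have "\<dots> = (\<Prod>e\<in>s ` ?L. \<Prod>l\<in>{l\<in>?L. s l = e}. s l)"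
  proof (intro prod.cong refl)
    fix e assume "e \<in> s ` ?L"
    then have "{l\<in>?L. s l = e} = {l. l < n \<and> s l = e}" by auto
    then show "e ^ card {l. l < n \<and> s l = e} = (\<Prod>l\<in>{l\<in>?L. s l = e}. s l)" by simp
  qed
  also have "\<dots> = (\<Prod>l\<in>?L. s l)"
    by (rule prod.image_gen[symmetric]) simp
  finally show ?thesis .
qed

section \<open>Simultaneous diagonalisation of the penalties\<close>

lemma congruence_diagonal_entry:
  fixes U G :: "real mat"
  assumes U: "U \<in> carrier_mat n n" and G: "G \<in> carrier_mat n n" "diagonal_mat G"
    and rc: "r < n" "c < n"
  shows "(U * G * transpose_mat U) $$ (r, c) = (\<Sum>l<n. U $$ (r, l) * G $$ (l, l) * U $$ (c, l))"
proof -
  have UG: "(U * G) $$ (r, l) = U $$ (r, l) * G $$ (l, l)" if "l < n" for l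
  proof -
    have "(U * G) $$ (r, l) = (\<Sum>i<n. U $$ (r, i) * G $$ (i, l))"
      using U G rc that by (simp add: scalar_prod_def atLeast0LessThan)
    also have "\<dots> = (\<Sum>i<n. if i = l then U $$ (r, l) * G $$ (l, l) else 0)"
      using G that by (intro sum.cong refl) (auto simp: diagonal_mat_def)
    also have "\<dots> = U $$ (r, l) * G $$ (l, l)" using that by simp
    finally show ?thesis .
  qed
  have "(V * transpose_mat U) $$ (r, c) = (\<Sum>l<n. V $$ (r, l) * U $$ (c, l))"
    if "V \<in> carrier_mat n n" for V
    using that U rc by (simp add: scalar_prod_def atLeast0LessThan)
  from this[OF mult_carrier_mat[OF U G(1)]] show ?thesis using UG by simp
qed

context
  fixes d :: "'p::{finite,linorder} \<Rightarrow> nat" and Q G :: "'p \<Rightarrow> real mat"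
  assumes dec: "\<And>j. orthogonal_eigendecomposition (d j) (marginal_penalty (d j)) (Q j) (G j)"
begin

lemma kron_at_carrier:
  assumes "M \<in> carrier_mat (d j) (d j)"
  shows "kron_at d j M \<in> carrier_mat (total_dim d) (total_dim d)"
  unfolding kron_at_def using assms by (intro kron_all_carrier) auto

lemma penalty_carrier: "penalty d j \<in> carrier_mat (total_dim d) (total_dim d)"
  unfolding penalty_def
  by (rule kron_at_carrier) (use diff2_mat_carrier[of "d j"] in \<open>auto simp: marginal_penalty_def\<close>)

lemma Gamma_carrier: "kron_at d j (G j) \<in> carrier_mat (total_dim d) (total_dim d)"
  using orthogonal_eigendecompositionD(2)[OF dec] by (rule kron_at_carrier)

lemma Gamma_nonneg_diagonal: "nonneg_diagonal (kron_at d j (G j))"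
  unfolding kron_at_def
proof (rule nonneg_diagonal_kron_all[of _ d])
  show "nonneg_diagonal (if i = j then G j else 1\<^sub>m (d i))" for i
    using gram_nonneg_diagonal[OF dec[unfolded marginal_penalty_def] diff2_mat_carrier]
    by (simp add: nonneg_diagonal_one)
qed (use orthogonal_eigendecompositionD(2)[OF dec] in auto)

text \<open>This excludes cancellation between the summands of \<open>S_sum\<close>.\<close>

lemma gamma_nonneg: "l < total_dim d \<Longrightarrow> gamma d G j l \<ge> 0"
  using Gamma_nonneg_diagonal[of j] Gamma_carrier[of j]
  by (auto simp: gamma_def nonneg_diagonal_def)

lemma kron_all_Q_carrier: "kron_all Q \<in> carrier_mat (total_dim d) (total_dim d)"
  by (rule kron_all_carrier) (rule orthogonal_eigendecompositionD(1)[OF dec])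

lemma kron_all_Q_orthogonal:
  "transpose_mat (kron_all Q) * kron_all Q = 1\<^sub>m (total_dim d)"
  "kron_all Q * transpose_mat (kron_all Q) = 1\<^sub>m (total_dim d)"
proof -
  note D = orthogonal_eigendecompositionD[OF dec]
  have Qt: "transpose_mat (Q i) \<in> carrier_mat (d i) (d i)" for i using D(1) by simp
  show "transpose_mat (kron_all Q) * kron_all Q = 1\<^sub>m (total_dim d)"
    unfolding kron_all_transpose
    by (subst kron_all_mult[of _ d d _ d]) (use D(1) Qt in \<open>simp_all add: D(3) kron_all_one\<close>)
  show "kron_all Q * transpose_mat (kron_all Q) = 1\<^sub>m (total_dim d)"
    unfolding kron_all_transpose
    by (subst kron_all_mult[of _ d d _ d]) (use D(1) Qt in \<open>simp_all add: D(4) kron_all_one\<close>)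
qed

text \<open>Two uses of the mixed-product property reduce the claim to the single factors. Factor
  \<open>j\<close> is the given eigendecomposition; every other factor is
  \<open>Q i * 1 * Q i^T\<close>, the identity by orthogonality.\<close>

lemma penalty_eigendecomposition:
  "penalty d j = kron_all Q * kron_at d j (G j) * transpose_mat (kron_all Q)"
proof -
  note D = orthogonal_eigendecompositionD[OF dec]
  let ?G = "\<lambda>i. if i = j then G j else 1\<^sub>m (d i)"
  have Qt: "transpose_mat (Q i) \<in> carrier_mat (d i) (d i)" for i using D(1) by simp
  have Gc: "?G i \<in> carrier_mat (d i) (d i)" for i using D(2) by auto
  have QG: "Q i * ?G i \<in> carrier_mat (d i) (d i)" for i
    by (rule mult_carrier_mat[OF D(1) Gc])
  have "kron_all Q * kron_all ?G * transpose_mat (kron_all Q)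
      = kron_all (\<lambda>i. Q i * ?G i * transpose_mat (Q i))"
    unfolding kron_all_transpose kron_all_mult[of Q d d ?G d, OF D(1) Gc]
    by (rule kron_all_mult[of _ d d _ d, OF QG Qt])
  also have "(\<lambda>i. Q i * ?G i * transpose_mat (Q i))
      = (\<lambda>i. if i = j then marginal_penalty (d j) else 1\<^sub>m (d i))"
    using D(4,6) by (auto simp: fun_eq_iff right_mult_one_mat[OF D(1)])
  finally show ?thesis by (simp add: penalty_def kron_at_def)
qed

text \<open>The entry is linear in the \<open>gamma d G j l\<close> with coefficients that do not
  depend on \<open>j\<close>, so the weighted sum over \<open>j\<close> can be taken inside.\<close>

lemma penalty_entry:
  assumes "r < total_dim d" "c < total_dim d"
  shows "penalty d j $$ (r, c)
    = (\<Sum>l<total_dim d. kron_all Q $$ (r, l) * gamma d G j l * kron_all Q $$ (c, l))"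
  unfolding penalty_eigendecomposition gamma_def
  using congruence_diagonal_entry[OF kron_all_Q_carrier Gamma_carrier _ assms] Gamma_nonneg_diagonal
  by (auto simp: nonneg_diagonal_def)

lemma full_penalty_similar_diagonal:
  "similar_mat (full_penalty d (exp_vec \<rho>))
     (mat (total_dim d) (total_dim d) (\<lambda>(i, l). if i = l then S_sum d G i \<rho> else 0))"
  (is "similar_mat ?K ?D")
proof -
  let ?n = "total_dim d" and ?U = "kron_all Q"
  have K: "?K = ?U * ?D * transpose_mat ?U"
  proof (rule eq_matI)
    fix r c assume "r < dim_row (?U * ?D * transpose_mat ?U)" "c < dim_col (?U * ?D * transpose_mat ?U)"
    then have rc: "r < ?n" "c < ?n" using kron_all_Q_carrier by auto
    have "?K $$ (r, c) = (\<Sum>j\<in>UNIV. penalty d j $$ (r, c) / exp (\<rho> $ j))"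
      using rc by (simp add: full_penalty_def exp_vec_def)
    also have "\<dots> = (\<Sum>j\<in>UNIV. \<Sum>l<?n. ?U $$ (r, l) * (gamma d G j l * exp (- (\<rho> $ j))) * ?U $$ (c, l))"
      using rc by (intro sum.cong refl)
        (simp add: penalty_entry sum_divide_distrib exp_minus field_simps)
    \<comment> \<open>Exchanging the sums over \<open>j\<close> and \<open>l\<close> collects the
      weights of index \<open>l\<close> into \<open>S_sum d G l \<rho>\<close>.\<close>
    also have "\<dots> = (\<Sum>l<?n. ?U $$ (r, l) * S_sum d G l \<rho> * ?U $$ (c, l))"
      by (subst sum.swap) (simp add: S_sum_def sum_distrib_left sum_distrib_right)
    also have "\<dots> = (\<Sum>l<?n. ?U $$ (r, l) * ?D $$ (l, l) * ?U $$ (c, l))"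
      by (intro sum.cong) auto
    also have "\<dots> = (?U * ?D * transpose_mat ?U) $$ (r, c)"
      by (rule congruence_diagonal_entry[OF kron_all_Q_carrier _ _ rc, symmetric])
        (auto simp: diagonal_mat_def)
    finally show "?K $$ (r, c) = (?U * ?D * transpose_mat ?U) $$ (r, c)" .
  qed (use kron_all_Q_carrier in \<open>auto simp: full_penalty_def\<close>)
  \<comment> \<open>As \<open>?U\<close> is orthogonal, its transpose is its inverse, so the
    congruence is a similarity.\<close>
  have "similar_mat_wit ?K ?D ?U (transpose_mat ?U)"
    using kron_all_Q_orthogonal K kron_all_Q_carrier
    by (intro similar_mat_witI[of _ _ ?n]) (auto simp: full_penalty_def)
  then show ?thesis unfolding similar_mat_def by blast
qed

section \<open>Closed form of the log-full conditional\<close>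

lemma finite_pos_index: "finite (pos_index d G)"
  by (simp add: pos_index_def)

text \<open>One summand is strictly positive by the choice of \<open>l\<close>, and no summand is
  negative.\<close>

lemma S_sum_pos: "l \<in> pos_index d G \<Longrightarrow> S_sum d G l \<rho> > 0"
  unfolding S_sum_def pos_index_def
  by (auto intro!: sum_pos2 mult_nonneg_nonneg mult_pos_pos gamma_nonneg)

text \<open>Outside \<open>pos_index\<close> no \<open>gamma d G j l\<close> is positive, and none
  is negative, so all of them vanish.\<close>

lemma S_sum_eq_0: "l < total_dim d \<Longrightarrow> l \<notin> pos_index d G \<Longrightarrow> S_sum d G l \<rho> = 0"
  using gamma_nonneg[of l] unfolding S_sum_def pos_index_def
  by (intro sum.neutral ballI) (auto simp: not_less intro!: antisym)

text \<open>The indices with nonzero eigenvalue are the same for every \<rho>, so the sum has a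
  fixed index set and can be differentiated term by term although the penalty may be
  singular.\<close>

lemma ln_pseudo_det_full_penalty:
  "ln (pseudo_det (full_penalty d (exp_vec \<rho>))) = (\<Sum>l\<in>pos_index d G. ln (S_sum d G l \<rho>))"
proof -
  have "{l. l < total_dim d \<and> S_sum d G l \<rho> \<noteq> 0} = pos_index d G"
    using S_sum_pos[of _ \<rho>] S_sum_eq_0[of _ \<rho>] by (force simp: pos_index_def)
  then show ?thesis
    using pseudo_det_similar_diagonal[OF full_penalty_similar_diagonal[of \<rho>]]
      ln_prod[OF finite_pos_index, of "\<lambda>l. S_sum d G l \<rho>"] S_sum_pos[of _ \<rho>]
    by (simp add: less_imp_neq[symmetric])
qed

text \<open>The quadratic form is linear in the matrix; this isolates the dependence on \<rho> in
  the exponential weights.\<close>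

lemma quad_form_full_penalty:
  assumes b: "b \<in> carrier_vec (total_dim d)"
  shows "quad_form (full_penalty d (exp_vec \<rho>)) b
    = (\<Sum>j\<in>UNIV. quad_form (penalty d j) b * exp (- (\<rho> $ j)))"
proof -
  let ?n = "total_dim d"
  have qf: "quad_form A b = (\<Sum>r<?n. \<Sum>c<?n. vec_index b r * A $$ (r, c) * vec_index b c)" if "A \<in> carrier_mat ?n ?n" for A
    using that b unfolding quad_form_def
    by (auto simp: scalar_prod_def atLeast0LessThan sum_distrib_left mult.assoc intro!: sum.cong)
  have "quad_form (full_penalty d (exp_vec \<rho>)) b
      = (\<Sum>r<?n. \<Sum>c<?n. \<Sum>j\<in>UNIV. vec_index b r * penalty d j $$ (r, c) * vec_index b c * exp (- (\<rho> $ j)))"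
    by (subst qf) (auto simp: full_penalty_def exp_vec_def sum_distrib_left sum_distrib_right
        exp_minus field_simps intro!: sum.cong)
  also have "\<dots> = (\<Sum>r<?n. \<Sum>j\<in>UNIV. \<Sum>c<?n. vec_index b r * penalty d j $$ (r, c) * vec_index b c * exp (- (\<rho> $ j)))"
    by (intro sum.cong refl sum.swap)
  also have "\<dots> = (\<Sum>j\<in>UNIV. \<Sum>r<?n. \<Sum>c<?n. vec_index b r * penalty d j $$ (r, c) * vec_index b c * exp (- (\<rho> $ j)))"
    by (rule sum.swap)
  finally show ?thesis by (simp add: qf[OF penalty_carrier] sum_distrib_right)
qed

lemma log_full_conditional_eq:
  assumes "b \<in> carrier_vec (total_dim d)"
  shows "log_full_conditional d b q \<rho> = 1 / 2 * (\<Sum>l\<in>pos_index d G. ln (S_sum d G l \<rho>))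
     - 1 / 2 * (\<Sum>j\<in>UNIV. quad_form (penalty d j) b * exp (- (\<rho> $ j))) + ln (q \<rho>)"
  unfolding log_full_conditional_def ln_pseudo_det_full_penalty quad_form_full_penalty[OF assms] ..

end

section \<open>Calculus of partial derivatives\<close>

lemma has_partial_derivative_imp: "has_partial_derivative f j x c \<Longrightarrow> partial_derivative j f x = c"
  unfolding has_partial_derivative_def partial_derivative_def by (rule DERIV_imp_deriv)

lemma has_partial_derivative_const: "has_partial_derivative (\<lambda>_. c) j x 0"
  by (simp add: has_partial_derivative_def)

lemma has_partial_derivative_add:
  "has_partial_derivative f j x a \<Longrightarrow> has_partial_derivative g j x b
    \<Longrightarrow> has_partial_derivative (\<lambda>x. f x + g x) j x (a + b)"
  unfolding has_partial_derivative_def by (rule DERIV_add)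

lemma has_partial_derivative_cmult:
  "has_partial_derivative f j x a \<Longrightarrow> has_partial_derivative (\<lambda>x. c * f x) j x (c * a)"
  unfolding has_partial_derivative_def by (rule DERIV_cmult)

lemma has_partial_derivative_sum:
  "(\<And>i. i \<in> I \<Longrightarrow> has_partial_derivative (f i) j x (a i))
    \<Longrightarrow> has_partial_derivative (\<lambda>x. \<Sum>i\<in>I. f i x) j x (\<Sum>i\<in>I. a i)"
  unfolding has_partial_derivative_def by (rule DERIV_sum)

lemma has_partial_derivative_ln:
  "has_partial_derivative f j x a \<Longrightarrow> f x > 0 \<Longrightarrow> has_partial_derivative (\<lambda>x. ln (f x)) j x (a / f x)"
  unfolding has_partial_derivative_def by (auto intro!: derivative_eq_intros)

lemma has_partial_derivative_divide:
  "has_partial_derivative f j x a \<Longrightarrow> has_partial_derivative g j x b \<Longrightarrow> g x \<noteq> 0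
    \<Longrightarrow> has_partial_derivative (\<lambda>x. f x / g x) j x ((a * g x - f x * b) / (g x)\<^sup>2)"
  unfolding has_partial_derivative_def by (auto intro!: derivative_eq_intros simp: power2_eq_square)

lemma has_partial_derivative_exp_minus:
  "has_partial_derivative (\<lambda>x. exp (- (x $ k))) j x (if k = j then - exp (- (x $ j)) else 0)"
  unfolding has_partial_derivative_def by (auto intro!: derivative_eq_intros simp: axis_def)

text \<open>Only summand \<open>j\<close> varies along direction \<open>j\<close>. The rule serves
  both \<open>S_sum\<close> and the quadratic form in \<open>b\<close>.\<close>

lemma has_partial_derivative_exp_sum:
  "has_partial_derivative (\<lambda>x. \<Sum>i\<in>UNIV. a i * exp (- (x $ i))) j x (- (a j * exp (- (x $ j))))"
proof -
  have "(\<Sum>i\<in>UNIV. a i * (if i = j then - exp (- (x $ j)) else 0))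
      = (\<Sum>i\<in>UNIV. if i = j then a i * - exp (- (x $ j)) else 0)"
    by (intro sum.cong) auto
  also have "\<dots> = - (a j * exp (- (x $ j)))" by (simp add: sum.delta)
  finally show ?thesis
    using has_partial_derivative_sum[of UNIV "\<lambda>i x. a i * exp (- (x $ i))" j x,
        OF has_partial_derivative_cmult[OF has_partial_derivative_exp_minus]] by simp
qed

lemma has_partial_derivative_S_sum:
  "has_partial_derivative (S_sum d G l) j \<rho> (- (gamma d G j l * exp (- (\<rho> $ j))))"
  unfolding S_sum_def[abs_def] by (rule has_partial_derivative_exp_sum)

text \<open>Chain rule along the line through \<open>x\<close> in direction
  \<open>axis j 1\<close>.\<close>

lemma has_derivative_imp_partial:
  assumes "(f has_derivative f') (at x)"
  shows "has_partial_derivative f j x (f' (axis j 1))"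
proof -
  have "((\<lambda>t. x + t *\<^sub>R axis j 1) has_derivative (\<lambda>t. t *\<^sub>R axis j 1)) (at 0)"
    by (auto intro!: derivative_eq_intros)
  then have "((\<lambda>t. f (x + t *\<^sub>R axis j 1)) has_derivative (\<lambda>t. f' (t *\<^sub>R axis j 1))) (at 0)"
    by (rule has_derivative_compose) (simp add: assms)
  moreover have "(\<lambda>t. f' (t *\<^sub>R axis j 1)) = (*) (f' (axis j 1))"
    using has_derivative_linear[OF assms] by (auto simp: linear_cmul)
  ultimately show ?thesis
    unfolding has_partial_derivative_def has_field_derivative_def by simp
qed

text \<open>\<open>partial_derivative\<close> denotes some number even where no derivative exists,
  so existence has to be derived from the smoothness of \<open>q\<close>.\<close>

lemma ln_partial_derivatives:
  assumes pos: "\<And>x. q x > 0" and diff: "twice_differentiable q"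
  shows "has_partial_derivative (\<lambda>x. ln (q x)) k x (partial_derivative k (\<lambda>x. ln (q x)) x)"
    and "has_partial_derivative (partial_derivative k (\<lambda>x. ln (q x))) j x
      (partial_derivative j (partial_derivative k (\<lambda>x. ln (q x))) x)"
proof -
  obtain q' where q': "\<And>x. (q has_derivative blinfun_apply (q' x)) (at x)"
      and q'_diff: "\<And>x. q' differentiable (at x)"
    using diff by (auto simp: twice_differentiable_def)
  have first: "has_partial_derivative (\<lambda>x. ln (q x)) k x (q' x (axis k 1) / q x)" for k x
    by (intro has_partial_derivative_ln has_derivative_imp_partial q' pos)
  show "has_partial_derivative (\<lambda>x. ln (q x)) k x (partial_derivative k (\<lambda>x. ln (q x)) x)"
    unfolding has_partial_derivative_imp[OF first] by (rule first)
  \<comment> \<open>The first derivative is known at every point, which identifies it as a function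
    that can be differentiated again.\<close>
  have eq: "partial_derivative k (\<lambda>x. ln (q x)) = (\<lambda>x. q' x (axis k 1) / q x)"
    using has_partial_derivative_imp[OF first] by blast
  obtain q'' where q'': "(q' has_derivative q'') (at x)"
    using q'_diff by (auto simp: differentiable_def)
  \<comment> \<open>Evaluation at the fixed vector \<open>axis k 1\<close> is a bounded linear map
    on the space of functionals, so it commutes with differentiation.\<close>
  have "((\<lambda>x. q' x (axis k 1)) has_derivative (\<lambda>h. q'' h (axis k 1))) (at x)"
    by (rule bounded_linear.has_derivative[OF blinfun.bounded_linear_left q''])
  then have "has_partial_derivative (\<lambda>x. q' x (axis k 1)) j x (q'' (axis j 1) (axis k 1))"
    by (rule has_derivative_imp_partial)
  \<comment> \<open>Only the existence of some value \<open>c\<close> matters; uniqueness then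
    equates it with \<open>partial_derivative\<close>.\<close>
  from has_partial_derivative_divide[OF this has_derivative_imp_partial[OF q']]
  obtain c where "has_partial_derivative (\<lambda>x. q' x (axis k 1) / q x) j x c"
    using pos[of x] by auto
  then show "has_partial_derivative (partial_derivative k (\<lambda>x. ln (q x))) j x
      (partial_derivative j (partial_derivative k (\<lambda>x. ln (q x))) x)"
    unfolding eq by (simp add: has_partial_derivative_imp)
qed

theorem proposition3p4:
  fixes d :: "'p::{finite,linorder} \<Rightarrow> nat"
    and Q G :: "'p \<Rightarrow> real mat"
    and q logp :: "real ^ 'p::{finite,linorder} \<Rightarrow> real"
    and b :: "real Matrix.vec"
    and const :: real
  assumes "CARD('p) \<ge> 2"
    and "\<And>j. d j \<ge> 4"
    and "\<And>j. orthogonal_eigendecomposition (d j) (marginal_penalty (d j)) (Q j) (G j)"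
    and "\<And>\<rho>. q \<rho> > 0"
    and "twice_differentiable q"
    and "b \<in> carrier_vec (total_dim d)"
    and "\<And>\<rho>. logp \<rho> = log_full_conditional d b q \<rho> + const"
  shows "\<forall>\<rho> j0 k0.
      has_partial_derivative logp j0 \<rho>
        (- (1 / 2) * (\<Sum>l\<in>pos_index d G. gamma d G j0 l * exp (- (\<rho> $ j0)) / S_sum d G l \<rho>)
         + 1 / 2 * quad_form (penalty d j0) b * exp (- (\<rho> $ j0))
         + partial_derivative j0 (\<lambda>r. ln (q r)) \<rho>)
    \<and> has_partial_derivative (partial_derivative j0 logp) j0 \<rho>
        (- (1 / 2) * (\<Sum>l\<in>pos_index d G.
             (gamma d G j0 l * exp (- (\<rho> $ j0)) / S_sum d G l \<rho>)\<^sup>2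
             - gamma d G j0 l * exp (- (\<rho> $ j0)) / S_sum d G l \<rho>)
         - 1 / 2 * quad_form (penalty d j0) b * exp (- (\<rho> $ j0))
         + partial_derivative j0 (partial_derivative j0 (\<lambda>r. ln (q r))) \<rho>)
    \<and> (j0 \<noteq> k0 \<longrightarrow>
       has_partial_derivative (partial_derivative k0 logp) j0 \<rho>
        (- (1 / 2) * (\<Sum>l\<in>pos_index d G.
             gamma d G j0 l * exp (- (\<rho> $ j0)) * (gamma d G k0 l * exp (- (\<rho> $ k0)))
               / (S_sum d G l \<rho>)\<^sup>2)
         + partial_derivative j0 (partial_derivative k0 (\<lambda>r. ln (q r))) \<rho>))"
proof -
  \<comment> \<open>\<open>a j l\<close> is the summand \<open>j\<close> of
    \<open>S_sum d G l\<close>. Its derivative in direction \<open>j\<close> is its own negative,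
    and it is constant in all other directions.\<close>
  define a where "a j l = (\<lambda>\<rho> :: real ^ 'p::{finite,linorder}. gamma d G j l * exp (- (\<rho> $ j)))" for j l
  let ?S = "S_sum d G" and ?\<kappa> = "\<lambda>j. quad_form (penalty d j) b" and ?T = "pos_index d G"
  let ?q = "\<lambda>r. ln (q r)"
  note q_partial = ln_partial_derivatives[OF assms(4,5)]
  have S_pos: "?S l \<rho> > 0" if "l \<in> ?T" for l \<rho>
    using S_sum_pos[OF assms(3) that] .
  \<comment> \<open>The minus sign is absorbed into the coefficient, so that the rules for sums and
    constant multiples suffice.\<close>
  have logp: "logp = (\<lambda>\<rho>. 1 / 2 * (\<Sum>l\<in>?T. ln (?S l \<rho>))
      + - (1 / 2) * (\<Sum>j\<in>UNIV. ?\<kappa> j * exp (- (\<rho> $ j))) + ?q \<rho> + const)"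
    using assms(7) log_full_conditional_eq[OF assms(3,6)] by auto
  have S_partial: "has_partial_derivative (?S l) j \<rho> (- a j l \<rho>)" for l j \<rho>
    unfolding a_def by (rule has_partial_derivative_S_sum)
  have first: "has_partial_derivative logp j \<rho> (- (1 / 2) * (\<Sum>l\<in>?T. a j l \<rho> / ?S l \<rho>)
      + 1 / 2 * ?\<kappa> j * exp (- (\<rho> $ j)) + partial_derivative j ?q \<rho>)" for j \<rho>
  proof -
    \<comment> \<open>The derivative in the shape the rules produce; the final 0 comes from
      \<open>const\<close>.\<close>
    have "has_partial_derivative logp j \<rho> (1 / 2 * (\<Sum>l\<in>?T. - a j l \<rho> / ?S l \<rho>)
        + - (1 / 2) * (- (?\<kappa> j * exp (- (\<rho> $ j)))) + partial_derivative j ?q \<rho> + 0)"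
      unfolding logp
      by (intro has_partial_derivative_add has_partial_derivative_cmult has_partial_derivative_sum
          has_partial_derivative_ln has_partial_derivative_exp_sum has_partial_derivative_const
          S_partial S_pos q_partial(1))
    then show ?thesis by (simp add: sum_negf)
  qed
  have a_partial: "has_partial_derivative (a k l) j \<rho> (if k = j then - a j l \<rho> else 0)" for k l j \<rho>
    using has_partial_derivative_cmult[OF has_partial_derivative_exp_minus, of "gamma d G k l" k j \<rho>]
    by (cases "k = j") (simp_all add: a_def[abs_def])
  \<comment> \<open>The case distinction on \<open>k = j\<close> treats pure and mixed second
    derivatives by one computation.\<close>
  have second: "has_partial_derivative (partial_derivative k logp) j \<rho>
      (- (1 / 2) * (\<Sum>l\<in>?T. a j l \<rho> * a k l \<rho> / (?S l \<rho>)\<^sup>2 - (if k = j then a j l \<rho> / ?S l \<rho> else 0))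
       - (if k = j then 1 / 2 * ?\<kappa> j * exp (- (\<rho> $ j)) else 0)
       + partial_derivative j (partial_derivative k ?q) \<rho>)" for j k \<rho>
  proof -
    \<comment> \<open>Numerator of the quotient rule for \<open>a k l / ?S l\<close>: for
      \<open>k = j\<close> one factor \<open>?S l\<close>, positive on \<open>?T\<close>, cancels;
      otherwise only the product term remains.\<close>
    have quot: "((if k = j then - a j l \<rho> else 0) * ?S l \<rho> - a k l \<rho> * - a j l \<rho>) / (?S l \<rho>)\<^sup>2
        = a j l \<rho> * a k l \<rho> / (?S l \<rho>)\<^sup>2 - (if k = j then a j l \<rho> / ?S l \<rho> else 0)"
      if "l \<in> ?T" for l
      using S_pos[OF that, of \<rho>] by (auto simp: field_simps power2_eq_square)
    have eq: "partial_derivative k logp = (\<lambda>\<rho>. - (1 / 2) * (\<Sum>l\<in>?T. a k l \<rho> / ?S l \<rho>)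
      + 1 / 2 * ?\<kappa> k * exp (- (\<rho> $ k)) + partial_derivative k ?q \<rho>)"
      using has_partial_derivative_imp[OF first] by blast
    have "has_partial_derivative (partial_derivative k logp) j \<rho>
      (- (1 / 2) * (\<Sum>l\<in>?T. ((if k = j then - a j l \<rho> else 0) * ?S l \<rho> - a k l \<rho> * - a j l \<rho>) / (?S l \<rho>)\<^sup>2)
       + 1 / 2 * ?\<kappa> k * (if k = j then - exp (- (\<rho> $ j)) else 0)
       + partial_derivative j (partial_derivative k ?q) \<rho>)"
      unfolding eq using S_pos q_partial(2)[of k j \<rho>]
      by (intro has_partial_derivative_add has_partial_derivative_cmult has_partial_derivative_sum
          has_partial_derivative_divide has_partial_derivative_exp_minus a_partial S_partial)
        (auto simp: less_imp_neq[symmetric])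
    then show ?thesis using quot by (cases "k = j") (simp_all add: mult.commute)
  qed
  show ?thesis
  proof (intro allI conjI impI)
    fix \<rho> :: "real ^ 'p::{finite,linorder}" and j k :: 'p
    show "has_partial_derivative logp j \<rho>
        (- (1 / 2) * (\<Sum>l\<in>?T. gamma d G j l * exp (- (\<rho> $ j)) / ?S l \<rho>)
         + 1 / 2 * ?\<kappa> j * exp (- (\<rho> $ j)) + partial_derivative j ?q \<rho>)"
      using first[of j \<rho>] by (simp only: a_def)
    show "has_partial_derivative (partial_derivative j logp) j \<rho>
        (- (1 / 2) * (\<Sum>l\<in>?T. (gamma d G j l * exp (- (\<rho> $ j)) / ?S l \<rho>)\<^sup>2
             - gamma d G j l * exp (- (\<rho> $ j)) / ?S l \<rho>)
         - 1 / 2 * ?\<kappa> j * exp (- (\<rho> $ j)) + partial_derivative j (partial_derivative j ?q) \<rho>)"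
      \<comment> \<open>With both directions equal, \<open>a j l * a j l / (?S l)^2\<close> is the
        square of the quotient. The pattern \<open>_ * exp _\<close> expands the square of the
        numerator only and leaves that of the denominator intact.\<close>
      using second[of j j \<rho>]
      by (simp only: a_def power_divide if_True power2_eq_square[of "_ * exp _"] simp_thms)
    show "has_partial_derivative (partial_derivative k logp) j \<rho>
        (- (1 / 2) * (\<Sum>l\<in>?T. gamma d G j l * exp (- (\<rho> $ j)) * (gamma d G k l * exp (- (\<rho> $ k)))
               / (?S l \<rho>)\<^sup>2) + partial_derivative j (partial_derivative k ?q) \<rho>)" if "j \<noteq> k"
      using second[of k j \<rho>] not_sym[OF that] by (simp only: a_def if_False diff_0_right)
  qed
qed

end
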